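(* Let $q$ be a prime power and $r$ a positive integer. Let $n\le q-1$ be a positive integer, written as $n=mr+s$ with integers $m\ge 0$ and $1\le s\le r$, and let $d\le s$ be a positive integer. Then there exists a Singleton-optimal $[n+\lceil \frac{n}{r}\rceil,\,n-d+1,\,d+1;\,r]_q$-locally repairable code.
   Context: An $[n,k,d]_q$-linear code is a $k$-dimensional nonzero subspace of $\mathbb{F}_q^n$ with minimum Hamming distance $d$. It has locality $r$ if for every coordinate $i$ there is a set $R\subseteq[n]\setminus\{i\}$, $|R|\le r$, such that codewords agreeing on $R$ also agree at $i$; equivalently, every coordinate $i$ lies in the support of some dual codeword of weight at most $r+1$. An $[n,k,d;r]_q$-locally repairable code is an $[n,k,d]_q$-linear code with locality $r$. Every $[N,K,D;r]_q$-locally repairable code satisfies the Singleton-type bound $D\le N-K-\lceil K/r\rceil+2$; the code is called Singleton-optimal if equality holds. *)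

theory Defs
  imports Complex_Main "HOL-Library.Cardinality" "Jordan_Normal_Form.VS_Connect"
begin

text \<open>
  The field with \<open>q\<close> elements is a type \<open>'a\<close> of sort \<open>{field, finite}\<close> with \<open>CARD('a) = q\<close>, and
  the ambient space of length \<open>N\<close> is \<open>carrier_vec N\<close>, with coordinates \<open>0, \<dots>, N - 1\<close>.
\<close>

definition hamming_dist :: "'a vec \<Rightarrow> 'a vec \<Rightarrow> nat" where
  "hamming_dist x y = card {i. i < dim_vec x \<and> x $ i \<noteq> y $ i}"

text \<open>Only meaningful for sets with at least two elements, such as nonzero linear codes.\<close>

definition min_dist :: "'a vec set \<Rightarrow> nat" where
  "min_dist C = Inf {hamming_dist x y | x y. x \<in> C \<and> y \<in> C \<and> x \<noteq> y}"

definition linear_code :: "nat \<Rightarrow> nat \<Rightarrow> nat \<Rightarrow> 'a :: {field, finite} vec set \<Rightarrow> bool" where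
  "linear_code N K D C \<longleftrightarrow>
     subspace class_ring C (module_vec TYPE('a) N) \<and>
     C \<noteq> {0\<^sub>v N} \<and>
     vectorspace.dim class_ring ((module_vec TYPE('a) N)\<lparr>carrier := C\<rparr>) = K \<and>
     min_dist C = D"

definition has_locality :: "nat \<Rightarrow> nat \<Rightarrow> 'a vec set \<Rightarrow> bool" where
  "has_locality N r C \<longleftrightarrow>
     (\<forall>i<N. \<exists>R \<subseteq> {..<N} - {i}. card R \<le> r \<and>
        (\<forall>x\<in>C. \<forall>y\<in>C. (\<forall>j\<in>R. x $ j = y $ j) \<longrightarrow> x $ i = y $ i))"

definition locally_repairable_code ::
  "nat \<Rightarrow> nat \<Rightarrow> nat \<Rightarrow> nat \<Rightarrow> 'a :: {field, finite} vec set \<Rightarrow> bool" where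
  "locally_repairable_code N K D r C \<longleftrightarrow> linear_code N K D C \<and> has_locality N r C"

text \<open>Equality in the Singleton-type bound, stated over the integers to avoid truncated subtraction.\<close>

definition singleton_optimal :: "nat \<Rightarrow> nat \<Rightarrow> nat \<Rightarrow> nat \<Rightarrow> bool" where
  "singleton_optimal N K D r \<longleftrightarrow> int D = int N - int K - \<lceil>real K / real r\<rceil> + 2"

definition singleton_optimal_lrc ::
  "nat \<Rightarrow> nat \<Rightarrow> nat \<Rightarrow> nat \<Rightarrow> 'a :: {field, finite} vec set \<Rightarrow> bool" where
  "singleton_optimal_lrc N K D r C \<longleftrightarrow>
     locally_repairable_code N K D r C \<and> singleton_optimal N K D r"

end

theory Submission
  imports Defs
begin

text \<open>
  Choose distinct nonzero field elements \<open>\<alpha>\<^sub>i\<close>. The data part of the code is the MDS code of length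
  \<open>n\<close> cut out by \<open>\<Sum>\<^sub>i c\<^sub>i \<alpha>\<^sub>i\<^sup>j = 0\<close> for \<open>1 \<le> j < d\<close>, which has minimum distance \<open>d\<close>; the data
  coordinates are split into \<open>m + 1\<close> groups of size at most \<open>r\<close>, and each group gets a parity
  coordinate equal to its sum. If all parities of a codeword vanish, then the equation for \<open>j = 0\<close>
  holds as well, so by the Vandermonde argument the data part has weight at least \<open>d + 1\<close>;
  otherwise a nonzero parity adds one to a data weight of at least \<open>d\<close>.
\<close>

section \<open>Vandermonde systems\<close>

text \<open>By linearity, the functional taking \<open>p\<close> to the sum of
  \<open>c k * poly p (\<alpha> k)\<close> kills every polynomial of degree below
  \<open>card S\<close>. Testing it on the product of the linear factors of all nodes but
  \<open>\<alpha> i\<close> isolates \<open>c i\<close>.\<close>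

lemma power_sums_zero_imp_zero:
  fixes \<alpha> c :: "nat \<Rightarrow> 'a :: field"
  assumes fin: "finite S" and inj: "inj_on \<alpha> S"
    and sums: "\<And>j. j < card S \<Longrightarrow> (\<Sum>i\<in>S. c i * \<alpha> i ^ j) = 0"
    and i: "i \<in> S"
  shows "c i = 0"
proof -
  have poly_sum: "(\<Sum>k\<in>S. c k * poly p (\<alpha> k)) = 0" if deg: "degree p < card S" for p
  proof -
    have "(\<Sum>k\<in>S. c k * poly p (\<alpha> k)) = (\<Sum>k\<in>S. \<Sum>j\<le>degree p. coeff p j * (c k * \<alpha> k ^ j))"
      by (simp add: poly_altdef sum_distrib_left mult_ac)
    also have "\<dots> = (\<Sum>j\<le>degree p. coeff p j * (\<Sum>k\<in>S. c k * \<alpha> k ^ j))"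
      by (subst sum.swap) (simp add: sum_distrib_left)
    also have "\<dots> = 0"
      using deg by (intro sum.neutral) (auto simp: sums)
    finally show ?thesis .
  qed
  define p where "p = (\<Prod>k\<in>S - {i}. [:- \<alpha> k, 1:])"
  have "degree p = card (S - {i})"
    unfolding p_def by (subst degree_prod_eq_sum_degree) auto
  then have "degree p < card S"
    using card_Diff1_less[OF fin i] by simp
  then have "(\<Sum>k\<in>S. c k * poly p (\<alpha> k)) = 0"
    by (rule poly_sum)
  moreover have "(\<Sum>k\<in>S. c k * poly p (\<alpha> k)) = c i * poly p (\<alpha> i)"
  proof -
    have "poly p (\<alpha> k) = 0" if "k \<in> S - {i}" for k
      using that fin by (auto simp: p_def poly_prod)
    then show ?thesis
      using fin i by (simp add: sum.remove)
  qed
  moreover have "poly p (\<alpha> i) \<noteq> 0"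
    using fin i inj by (auto simp: p_def poly_prod inj_on_def)
  ultimately show ?thesis
    by simp
qed

text \<open>An injective map of a finite set into itself is onto. This later solves for the check
  coordinates of a codeword.\<close>

lemma power_sums_surj:
  fixes \<alpha> :: "nat \<Rightarrow> 'a :: {field, finite}"
  assumes inj: "inj_on \<alpha> {..<k}" and nz: "\<And>i. i < k \<Longrightarrow> \<alpha> i \<noteq> 0"
  obtains x where "\<And>j. j < k \<Longrightarrow> (\<Sum>i<k. x i * \<alpha> i ^ Suc j) = b j"
proof -
  let ?E = "PiE {..<k} (\<lambda>_. UNIV :: 'a set)"
  \<comment> \<open>Both sides are extensional functions on \<open>{..<k}\<close>, so
    \<open>T\<close> maps the finite set \<open>?E\<close> into itself.\<close>
  define T where "T x = (\<lambda>j\<in>{..<k}. \<Sum>i<k. x i * \<alpha> i ^ Suc j)" for x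
  have "inj_on T ?E"
  proof (rule inj_onI)
    fix x y assume x: "x \<in> ?E" and y: "y \<in> ?E" and eq: "T x = T y"
    \<comment> \<open>Absorbing one factor \<open>\<alpha> i\<close> into the coefficient makes the
      exponents start at 0.\<close>
    have "(x i - y i) * \<alpha> i = 0" if "i < k" for i
    proof (rule power_sums_zero_imp_zero[of "{..<k}" \<alpha> "\<lambda>i. (x i - y i) * \<alpha> i"])
      fix j assume "j < card {..<k}"
      then show "(\<Sum>i<k. (x i - y i) * \<alpha> i * \<alpha> i ^ j) = 0"
        using fun_cong[OF eq, of j] by (simp add: T_def algebra_simps sum_subtractf)
    qed (use inj that in auto)
    then show "x = y"
      using nz by (intro PiE_ext[OF x y]) auto
  qed
  moreover have "T ` ?E \<subseteq> ?E"
    by (rule image_subsetI) (simp add: T_def)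
  ultimately have "T ` ?E = ?E"
    by (intro endo_inj_surj) (simp_all add: finite_PiE)
  moreover have "restrict b {..<k} \<in> ?E"
    by auto
  ultimately have "restrict b {..<k} \<in> T ` ?E"
    by simp
  then obtain x where x: "restrict b {..<k} = T x"
    by (rule imageE)
  have "(\<Sum>i<k. x i * \<alpha> i ^ Suc j) = b j" if "j < k" for j
    using fun_cong[OF x[symmetric], of j, unfolded T_def] that by simp
  then show ?thesis
    by (rule that)
qed

section \<open>Criteria for subspaces, dimension and minimum distance\<close>

lemma subspace_vecI:
  fixes C :: "'a :: field vec set"
  assumes "C \<subseteq> carrier_vec N" "0\<^sub>v N \<in> C"
    and "\<And>x y. x \<in> C \<Longrightarrow> y \<in> C \<Longrightarrow> x + y \<in> C" "\<And>a x. x \<in> C \<Longrightarrow> a \<cdot>\<^sub>v x \<in> C"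
  shows "subspace class_ring C (module_vec TYPE('a) N)"
  unfolding subspace_def
  using assms by (auto intro!: vec_vs submodule.intro vec_module simp: module_vec_simps)

lemma finite_carrier_vec: "finite (carrier_vec n :: 'a :: finite vec set)"
proof (rule finite_subset)
  show "carrier_vec n \<subseteq> vec_of_list ` {xs :: 'a list. set xs \<subseteq> UNIV \<and> length xs = n}"
    by (auto intro!: image_eqI[of _ vec_of_list "list_of_vec _"] simp: vec_list)
qed (intro finite_imageI finite_lists_length_eq finite)

text \<open>A linear bijection preserves dimension. The space is finite-dimensional because the
  finite set \<open>C\<close> spans itself.\<close>

lemma dim_subspace_vec_eqI:
  fixes C :: "'a :: {field, finite} vec set" and f :: "'a vec \<Rightarrow> 'a vec"
  assumes sub: "subspace class_ring C (module_vec TYPE('a) N)"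
    and add: "\<And>x y. x \<in> C \<Longrightarrow> y \<in> C \<Longrightarrow> f (x + y) = f x + f y"
    and smult: "\<And>a x. x \<in> C \<Longrightarrow> f (a \<cdot>\<^sub>v x) = a \<cdot>\<^sub>v f x"
    and bij: "bij_betw f C (carrier_vec K)"
  shows "vectorspace.dim class_ring ((module_vec TYPE('a) N)\<lparr>carrier := C\<rparr>) = K"
proof -
  interpret W: vec_space "TYPE('a)" K .
  let ?V = "(module_vec TYPE('a) N)\<lparr>carrier := C\<rparr>"
  interpret V: vectorspace class_ring ?V
    by (rule vectorspace.subspace_is_vs[OF vec_vs sub])
  have fC: "f x \<in> carrier_vec K" if "x \<in> C" for x
    using bij that by (auto simp: bij_betw_def)
  interpret L: linear_map class_ring ?V "module_vec TYPE('a) K" f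
  proof (intro linear_map.intro mod_hom.intro mod_hom_axioms.intro)
    show "f \<in> LinearCombinations.module_hom class_ring ?V (module_vec TYPE('a) K)"
      by (simp add: LinearCombinations.module_hom_def module_vec_simps add smult fC)
  qed (rule V.vectorspace_axioms V.module_axioms vec_vs vec_module)+
  have "finite C"
    using bij_betw_finite[OF bij] finite_carrier_vec by blast
  then have "V.fin_dim"
    unfolding V.fin_dim_def
    using V.in_own_span[of C] V.span_is_subset2[of C]
    by (intro exI[of _ C]) auto
  then show ?thesis
    using L.dim_eq bij W.dim_is_n by (auto simp: bij_betw_def module_vec_simps)
qed

text \<open>The distance of \<open>x\<close> and \<open>y\<close> is the weight of
  \<open>x - y\<close>, again a codeword, so the minimum distance is the least nonzero
  weight.\<close>

lemma min_dist_eqI: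
  fixes C :: "'a :: field vec set"
  assumes C: "C \<subseteq> carrier_vec N" "0\<^sub>v N \<in> C"
    and diff: "\<And>x y. x \<in> C \<Longrightarrow> y \<in> C \<Longrightarrow> x - y \<in> C"
    and lower: "\<And>c. c \<in> C \<Longrightarrow> c \<noteq> 0\<^sub>v N \<Longrightarrow> D \<le> card {i. i < N \<and> c $ i \<noteq> 0}"
    and upper: "c \<in> C" "c \<noteq> 0\<^sub>v N" "card {i. i < N \<and> c $ i \<noteq> 0} \<le> D"
  shows "min_dist C = D"
proof -
  have ge: "D \<le> hamming_dist x y" if xy: "x \<in> C" "y \<in> C" "x \<noteq> y" for x y
  proof -
    have carr: "x \<in> carrier_vec N" "y \<in> carrier_vec N"
      using C xy by auto
    have "x - y \<noteq> 0\<^sub>v N"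
    proof
      assume eq: "x - y = 0\<^sub>v N"
      have "x $ i = y $ i" if "i < N" for i
        using arg_cong[OF eq, of "\<lambda>v. v $ i"] carr that by simp
      then show False
        using xy carr by (auto intro: eq_vecI)
    qed
    then have "D \<le> card {i. i < N \<and> (x - y) $ i \<noteq> 0}"
      using lower diff xy by blast
    also have "{i. i < N \<and> (x - y) $ i \<noteq> 0} = {i. i < dim_vec x \<and> x $ i \<noteq> y $ i}"
      using carr by auto
    finally show ?thesis
      by (simp add: hamming_dist_def)
  qed
  have "{i. i < dim_vec c \<and> c $ i \<noteq> 0\<^sub>v N $ i} = {i. i < N \<and> c $ i \<noteq> 0}"
    using C upper(1) by auto
  then have "hamming_dist c (0\<^sub>v N) = D"
    using upper lower[of c] by (simp add: hamming_dist_def)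
  then show ?thesis
    unfolding min_dist_def using ge C(2) upper(1,2)
    by (intro cInf_eq_minimum) auto
qed

section \<open>The code and its linearity\<close>

text \<open>Here \<open>b\<close> is the number of groups; \<open>n \<le> b * r\<close> ensures that
  they cover all data coordinates.\<close>

locale rs_lrc =
  fixes \<alpha> :: "nat \<Rightarrow> 'a :: {field, finite}" and n b r d :: nat
  assumes inj: "inj_on \<alpha> {..<n}" and nz: "\<And>i. i < n \<Longrightarrow> \<alpha> i \<noteq> 0"
    and n_le: "n \<le> b * r" and d_pos: "0 < d" and d_le_r: "d \<le> r" and d_le_n: "d \<le> n"
begin

text \<open>Positions below \<open>n\<close> hold data, cut into consecutive blocks of length
  \<open>r\<close>; position \<open>n + g\<close> holds the parity of block
  \<open>g\<close>.\<close>

definition code :: "'a vec set" where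
  "code = {c \<in> carrier_vec (n + b).
     (\<forall>j\<in>{1..<d}. (\<Sum>i<n. c $ i * \<alpha> i ^ j) = 0) \<and>
     (\<forall>g<b. c $ (n + g) = (\<Sum>i | i < n \<and> i div r = g. c $ i))}"

lemma group_less: "i < n \<Longrightarrow> i div r < b"
  using n_le by (simp add: less_mult_imp_div_less)

lemma codeD:
  assumes "c \<in> code"
  shows "c \<in> carrier_vec (n + b)"
    and "j \<in> {1..<d} \<Longrightarrow> (\<Sum>i<n. c $ i * \<alpha> i ^ j) = 0"
    and "g < b \<Longrightarrow> c $ (n + g) = (\<Sum>i | i < n \<and> i div r = g. c $ i)"
  using assms by (auto simp: code_def)

lemma code_zero: "0\<^sub>v (n + b) \<in> code"
  by (auto simp: code_def)

lemma code_add: "x \<in> code \<Longrightarrow> y \<in> code \<Longrightarrow> x + y \<in> code"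
  by (auto simp: code_def sum.distrib algebra_simps)

lemma code_smult: "x \<in> code \<Longrightarrow> a \<cdot>\<^sub>v x \<in> code"
  by (auto simp: code_def mult.assoc simp flip: sum_distrib_left)

lemma code_diff:
  assumes "x \<in> code" "y \<in> code"
  shows "x - y \<in> code"
proof -
  have "x - y = x + (- 1) \<cdot>\<^sub>v y"
    using codeD(1)[OF assms(1)] codeD(1)[OF assms(2)] by auto
  then show ?thesis
    using assms by (simp add: code_add code_smult)
qed

lemma subspace_code: "subspace class_ring code (module_vec TYPE('a) (n + b))"
  by (intro subspace_vecI code_zero code_add code_smult) (auto simp: code_def)

lemma code_eq_zeroI:
  assumes c: "c \<in> code" and zero: "\<And>i. i < n \<Longrightarrow> c $ i = 0"
  shows "c = 0\<^sub>v (n + b)"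
proof (rule eq_vecI)
  fix i assume "i < dim_vec (0\<^sub>v (n + b))"
  then show "c $ i = 0\<^sub>v (n + b) $ i"
    using zero codeD(3)[OF c, of "i - n"] by (cases "i < n") auto
qed (use codeD(1)[OF c] in auto)

section \<open>Lower bounds on weights\<close>

text \<open>The groups partition the data coordinates. This ties the missing power sum of exponent 0
  to the parities.\<close>

lemma sum_data_eq_sum_parity:
  assumes c: "c \<in> code"
  shows "(\<Sum>i<n. c $ i) = (\<Sum>g<b. c $ (n + g))"
proof -
  have "(\<Sum>i<n. c $ i) = (\<Sum>g<b. \<Sum>i | i \<in> {..<n} \<and> i div r = g. c $ i)"
    by (rule sum.group[symmetric]) (auto simp: group_less)
  then show ?thesis
    using codeD(3)[OF c] by simp
qed

lemma sum_support:
  fixes f :: "nat \<Rightarrow> 'a"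
  shows "(\<Sum>i | i < n \<and> c $ i \<noteq> 0. c $ i * f i) = (\<Sum>i<n. c $ i * f i)"
  by (rule sum.mono_neutral_left) auto

text \<open>With at most \<open>d - 1\<close> nonzero data entries, the \<open>d - 1\<close>
  power-sum equations form a Vandermonde system that forces them all to vanish, and the parities
  with them.\<close>

lemma data_weight_ge:
  assumes c: "c \<in> code" and ne: "c \<noteq> 0\<^sub>v (n + b)"
  shows "d \<le> card {i. i < n \<and> c $ i \<noteq> 0}"
proof (rule ccontr)
  let ?S = "{i. i < n \<and> c $ i \<noteq> 0}"
  assume less: "\<not> ?thesis"
  have "c $ i * \<alpha> i = 0" if "i \<in> ?S" for i
  proof (rule power_sums_zero_imp_zero[of ?S \<alpha> "\<lambda>i. c $ i * \<alpha> i"])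
    fix j assume "j < card ?S"
    then have "(\<Sum>i<n. c $ i * \<alpha> i ^ Suc j) = 0"
      using less by (intro codeD(2)[OF c]) auto
    then show "(\<Sum>i\<in>?S. c $ i * \<alpha> i * \<alpha> i ^ j) = 0"
      using sum_support[of c "\<lambda>i. \<alpha> i ^ Suc j"] by (simp add: mult.assoc)
  qed (use that inj in \<open>auto intro: inj_on_subset\<close>)
  then have "\<forall>i<n. c $ i = 0"
    using nz by auto
  then show False
    using code_eq_zeroI[OF c] ne by blast
qed

lemma weight_ge:
  assumes c: "c \<in> code" and ne: "c \<noteq> 0\<^sub>v (n + b)"
  shows "d + 1 \<le> card {i. i < n + b \<and> c $ i \<noteq> 0}"
proof -
  let ?S = "{i. i < n \<and> c $ i \<noteq> 0}" and ?T = "{i. i < n + b \<and> c $ i \<noteq> 0}"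
  have card_S: "d \<le> card ?S"
    using assms by (rule data_weight_ge)
  have le: "card ?S \<le> card ?T"
    by (rule card_mono) auto
  \<comment> \<open>As \<open>d \<le> card ?S \<le> card ?T\<close>, only total weight exactly
    \<open>d\<close> remains to be excluded.\<close>
  have "card ?T \<noteq> d"
  proof
    assume T: "card ?T = d"
    then have "card ?S = d"
      using card_S le by simp
    \<comment> \<open>All of the weight lies in the data part, so every parity vanishes.\<close>
    with T have eq: "?S = ?T"
      by (intro card_subset_eq) auto
    have parity: "c $ (n + g) = 0" if "g < b" for g
    proof -
      have "n + g \<notin> ?T"
        unfolding eq[symmetric] by simp
      then show ?thesis
        using that by simp
    qed
    \<comment> \<open>Exponent 0 is now available too, giving \<open>d\<close> equations for the
      \<open>d\<close> entries in the support.\<close>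
    have "c $ i = 0" if "i \<in> ?S" for i
    proof (rule power_sums_zero_imp_zero[of ?S \<alpha> "($) c"])
      fix j assume j: "j < card ?S"
      have "(\<Sum>i<n. c $ i * \<alpha> i ^ j) = 0"
      proof (cases "j = 0")
        case True
        then show ?thesis
          using sum_data_eq_sum_parity[OF c] parity by simp
      next
        case False
        then show ?thesis
          using codeD(2)[OF c] j \<open>card ?S = d\<close> by simp
      qed
      then show "(\<Sum>i\<in>?S. c $ i * \<alpha> i ^ j) = 0"
        by (simp add: sum_support)
    qed (use that inj in \<open>auto intro: inj_on_subset\<close>)
    then have "?S = {}"
      by blast
    with \<open>card ?S = d\<close> show False
      using d_pos by simp
  qed
  with card_S le show ?thesis
    by simp
qed

section \<open>Information set, dimension and minimum distance\<close>

text \<open>The last \<open>n - d + 1\<close> data coordinates form an information set; the first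
  \<open>d - 1\<close> act as checks.\<close>

definition message :: "'a vec \<Rightarrow> 'a vec" where
  "message c = vec (n - d + 1) (\<lambda>i. c $ (d - 1 + i))"

text \<open>Otherwise the data support would fit into the \<open>d - 1\<close> check positions,
  contradicting the data weight of at least \<open>d\<close>.\<close>

lemma message_zero_imp_zero:
  assumes c: "c \<in> code" and "message c = 0\<^sub>v (n - d + 1)"
  shows "c = 0\<^sub>v (n + b)"
proof (rule ccontr)
  assume "c \<noteq> 0\<^sub>v (n + b)"
  with c have "d \<le> card {i. i < n \<and> c $ i \<noteq> 0}"
    by (rule data_weight_ge)
  also have "{i. i < n \<and> c $ i \<noteq> 0} \<subseteq> {..<d - 1}"
  proof (rule subsetI, rule ccontr)
    fix i assume i: "i \<in> {i. i < n \<and> c $ i \<noteq> 0}" "i \<notin> {..<d - 1}"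
    then have "message c $ (i - (d - 1)) = c $ i"
      using d_le_n by (auto simp: message_def)
    then show False
      using assms(2) i d_le_n by auto
  qed
  then have "card {i. i < n \<and> c $ i \<noteq> 0} \<le> d - 1"
    using card_mono[of "{..<d - 1}"] by simp
  finally show False
    using d_pos by simp
qed

text \<open>Systematic encoding: the message entries are prescribed, the \<open>d - 1\<close> check
  entries solve the power-sum equations, and the parities follow.\<close>

lemma message_surj:
  assumes v: "v \<in> carrier_vec (n - d + 1)"
  obtains c where "c \<in> code" "message c = v"
proof -
  define k where "k = d - 1"
  have k: "k \<le> n" "n - d + 1 = n - k" "d = Suc k"
    using d_le_n d_pos by (auto simp: k_def)
  \<comment> \<open>The right-hand side is the contribution of the prescribed entries, moved across
    with a minus sign.\<close>
  obtain x where x: "\<And>j. j < k \<Longrightarrow>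
      (\<Sum>i<k. x i * \<alpha> i ^ Suc j) = - (\<Sum>i=k..<n. v $ (i - k) * \<alpha> i ^ Suc j)"
  proof (rule power_sums_surj[where b = "\<lambda>j. - (\<Sum>i=k..<n. v $ (i - k) * \<alpha> i ^ Suc j)"])
    show "inj_on \<alpha> {..<k}"
      using inj k(1) by (auto intro: inj_on_subset)
    show "\<alpha> i \<noteq> 0" if "i < k" for i
      using nz that k(1) by simp
  qed blast
  define y where "y i = (if i < k then x i else v $ (i - k))" for i
  define c where "c = vec (n + b) (\<lambda>i. if i < n then y i
    else \<Sum>l | l < n \<and> l div r = i - n. y l)"
  have c_data: "c $ i = y i" if "i < n" for i
    using that by (simp add: c_def)
  have "(\<Sum>i<n. c $ i * \<alpha> i ^ j) = 0" if "j \<in> {1..<d}" for j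
  proof -
    have "j = Suc (j - 1)" "j - 1 < k"
      using that k by auto
    then obtain l where l: "j = Suc l" "l < k"
      by blast
    have "(\<Sum>i<n. c $ i * \<alpha> i ^ j) = (\<Sum>i<n. y i * \<alpha> i ^ j)"
      by (simp add: c_data)
    also have "\<dots> = (\<Sum>i\<in>{..<k} \<union> {k..<n}. y i * \<alpha> i ^ j)"
      using k by (intro sum.cong) auto
    also have "\<dots> = (\<Sum>i<k. y i * \<alpha> i ^ j) + (\<Sum>i=k..<n. y i * \<alpha> i ^ j)"
      by (rule sum.union_disjoint) auto
    also have "\<dots> = 0"
      using x[OF l(2)] by (simp add: l(1) y_def)
    finally show ?thesis .
  qed
  then have "c \<in> code"
    by (auto simp: code_def c_data) (simp_all add: c_def)
  moreover have "message c = v"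
    using v k unfolding message_def k_def[symmetric]
    by (intro eq_vecI) (auto simp: c_data y_def)
  ultimately show ?thesis
    by (rule that)
qed

lemma bij_message: "bij_betw message code (carrier_vec (n - d + 1))"
proof -
  have "inj_on message code"
  proof (rule inj_onI)
    fix x y assume xy: "x \<in> code" "y \<in> code" and eq: "message x = message y"
    note carr = codeD(1)[OF xy(1)] codeD(1)[OF xy(2)]
    have "message (x - y) = 0\<^sub>v (n - d + 1)"
    proof (rule eq_vecI)
      fix i assume "i < dim_vec (0\<^sub>v (n - d + 1))"
      then show "message (x - y) $ i = 0\<^sub>v (n - d + 1) $ i"
        using arg_cong[OF eq, of "\<lambda>v. v $ i"] carr d_le_n d_pos by (auto simp: message_def)
    qed (simp add: message_def)
    then have diff: "x - y = 0\<^sub>v (n + b)"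
      using code_diff[OF xy] by (intro message_zero_imp_zero)
    have "x $ i = y $ i" if "i < n + b" for i
      using arg_cong[OF diff, of "\<lambda>v. v $ i"] carr that by simp
    then show "x = y"
      using carr by (intro eq_vecI) auto
  qed
  moreover have "message ` code = carrier_vec (n - d + 1)"
    using message_surj by (force simp: message_def)
  ultimately show ?thesis
    by (simp add: bij_betw_def)
qed

lemma dim_code:
  "vectorspace.dim class_ring ((module_vec TYPE('a) (n + b))\<lparr>carrier := code\<rparr>) = n - d + 1"
proof (rule dim_subspace_vec_eqI[OF subspace_code _ _ bij_message])
  fix x y assume "x \<in> code" "y \<in> code"
  then show "message (x + y) = message x + message y"
    using codeD(1)[of x] codeD(1)[of y] d_le_n d_pos by (auto simp: message_def)
next
  fix a x assume "x \<in> code"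
  then show "message (a \<cdot>\<^sub>v x) = a \<cdot>\<^sub>v message x"
    using codeD(1)[of x] d_le_n d_pos by (auto simp: message_def)
qed

text \<open>A codeword vanishing on all message coordinates but the first is supported on the first
  \<open>d \<le> r\<close> data coordinates, all of which lie in group \<open>0\<close>, so it activates only one parity.\<close>

lemma light_codeword:
  obtains c where "c \<in> code" "c \<noteq> 0\<^sub>v (n + b)" "card {i. i < n + b \<and> c $ i \<noteq> 0} \<le> d + 1"
proof -
  obtain c where c: "c \<in> code" and msg: "message c = unit_vec (n - d + 1) 0"
    using message_surj[of "unit_vec (n - d + 1) 0"] by auto
  have m: "c $ i = (if i = d - 1 then 1 else 0)" if "d - 1 \<le> i" "i < n" for i
    using arg_cong[OF msg, of "\<lambda>v. v $ (i - (d - 1))"] that d_le_n d_pos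
    by (auto simp: message_def)
  have data: "c $ i = 0" if "d \<le> i" "i < n" for i
    using m[of i] that d_pos by auto
  have parity: "c $ (n + g) = 0" if "0 < g" "g < b" for g
  proof -
    have "c $ i = 0" if "i < n" "i div r = g" for i
    proof (rule data)
      show "d \<le> i"
        \<comment> \<open>A positive quotient \<open>i div r\<close> forces
          \<open>r \<le> i\<close>, hence \<open>d \<le> i\<close>.\<close>
        using that \<open>0 < g\<close> d_le_r by (metis div_less not_less order_less_le_trans less_irrefl)
    qed (use that in auto)
    then show ?thesis
      using codeD(3)[OF c \<open>g < b\<close>] by simp
  qed
  \<comment> \<open>Position \<open>n\<close> carries the parity of group 0, the only parity that
    may be nonzero.\<close>
  have "{i. i < n + b \<and> c $ i \<noteq> 0} \<subseteq> insert n {..<d}"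
  proof
    fix i assume i: "i \<in> {i. i < n + b \<and> c $ i \<noteq> 0}"
    show "i \<in> insert n {..<d}"
    proof (rule ccontr)
      assume "i \<notin> insert n {..<d}"
      moreover from this have "\<not> i < n"
        using i data[of i] by auto
      ultimately have "n < i" "c $ i \<noteq> 0" "i - n < b"
        using i by auto
      then show False
        using parity[of "i - n"] by simp
    qed
  qed
  then have "card {i. i < n + b \<and> c $ i \<noteq> 0} \<le> card (insert n {..<d})"
    by (rule card_mono[rotated]) simp
  also have "\<dots> \<le> d + 1"
    using card_insert_le_m1[of "d + 1"] by (simp add: card_insert_if)
  finally have "card {i. i < n + b \<and> c $ i \<noteq> 0} \<le> d + 1" .
  moreover have "c $ (d - 1) \<noteq> 0"
    using m[of "d - 1"] d_pos d_le_n by simp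
  then have "c \<noteq> 0\<^sub>v (n + b)"
    using d_le_n d_pos by auto
  ultimately show ?thesis
    using c that by blast
qed

lemma min_dist_code: "min_dist code = d + 1"
proof -
  obtain c where "c \<in> code" "c \<noteq> 0\<^sub>v (n + b)" "card {i. i < n + b \<and> c $ i \<noteq> 0} \<le> d + 1"
    by (rule light_codeword)
  then show ?thesis
    by (intro min_dist_eqI[where N = "n + b" and c = c] code_zero code_diff weight_ge)
      (auto simp: codeD(1))
qed

section \<open>Locality\<close>

lemma card_group_le: "card {i. i < n \<and> i div r = g} \<le> r"
proof -
  have "{i. i < n \<and> i div r = g} \<subseteq> {g * r..<g * r + r}"
    using d_pos d_le_r dividend_less_div_times[of r]
    by (auto simp: add.commute)
  then have "card {i. i < n \<and> i div r = g} \<le> card {g * r..<g * r + r}"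
    by (rule card_mono[rotated]) simp
  then show ?thesis
    by simp
qed

text \<open>A group and its parity satisfy one linear relation in which every coefficient is 1 or
  -1, so each entry is determined by the others, at most \<open>r\<close> in number.\<close>

lemma has_locality_code: "has_locality (n + b) r code"
  unfolding has_locality_def
proof (intro allI impI)
  fix i assume i: "i < n + b"
  define G where "G g = {l. l < n \<and> l div r = g}" for g
  have fin: "finite (G g)" and card_G: "card (G g) \<le> r" and n_notin: "n + h \<notin> G g" for g h
    using card_group_le[of g] by (auto simp: G_def)
  have parity: "c $ (n + g) = sum (($) c) (G g)" if "c \<in> code" "g < b" for c g
    using codeD(3)[OF that] by (simp add: G_def)
  show "\<exists>R\<subseteq>{..<n + b} - {i}. card R \<le> r \<and>
      (\<forall>x\<in>code. \<forall>y\<in>code. (\<forall>j\<in>R. x $ j = y $ j) \<longrightarrow> x $ i = y $ i)"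
  proof (cases "i < n")
    case True
    define g where "g = i div r"
    have iG: "i \<in> G g" and g: "g < b"
      using True group_less by (auto simp: G_def g_def)
    \<comment> \<open>The parity takes the place of \<open>i\<close>, so the repair set is as large
      as the group.\<close>
    let ?R = "insert (n + g) (G g - {i})"
    have "card ?R = card (G g)"
      using fin iG n_notin card_Suc_Diff1[of "G g" i] by simp
    then have "card ?R \<le> r"
      using card_G by simp
    moreover have "x $ i = y $ i" if xy: "x \<in> code" "y \<in> code" and eq: "\<forall>j\<in>?R. x $ j = y $ j" for x y
    proof -
      have "c $ i = c $ (n + g) - (\<Sum>l\<in>G g - {i}. c $ l)" if "c \<in> code" for c
        using parity[OF that g] fin iG by (simp add: sum.remove)
      moreover have "(\<Sum>l\<in>G g - {i}. x $ l) = (\<Sum>l\<in>G g - {i}. y $ l)"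
        using eq by (intro sum.cong) auto
      ultimately show ?thesis
        using xy eq by simp
    qed
    moreover have "?R \<subseteq> {..<n + b} - {i}"
      using True g by (auto simp: G_def)
    ultimately show ?thesis
      by (intro exI[of _ ?R] conjI ballI impI) blast+
  next
    case False
    then obtain g where g: "i = n + g" "g < b"
      using i by (metis add_less_cancel_left le_Suc_ex not_less)
    have "x $ i = y $ i" if "x \<in> code" "y \<in> code" "\<forall>j\<in>G g. x $ j = y $ j" for x y
      using that g by (auto simp: parity intro: sum.cong)
    moreover have "G g \<subseteq> {..<n + b} - {i}"
      using False by (auto simp: G_def)
    ultimately show ?thesis
      using card_G[of g] by (intro exI[of _ "G g"] conjI ballI impI) blast+
  qed
qed

lemma locally_repairable_code: "locally_repairable_code (n + b) (n - d + 1) (d + 1) r code"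
proof -
  have "code \<noteq> {0\<^sub>v (n + b)}"
    using light_codeword by blast
  then show ?thesis
    unfolding locally_repairable_code_def linear_code_def
    using subspace_code dim_code min_dist_code has_locality_code by blast
qed

end

section \<open>Parameters and Singleton optimality\<close>

lemma ceiling_divide_eq_Suc:
  fixes m r s :: nat
  assumes "1 \<le> s" "s \<le> r"
  shows "\<lceil>real (m * r + s) / real r\<rceil> = int m + 1"
proof -
  have "real (m * r + s) / real r = real m + real s / real r"
    using assms by (simp add: field_simps)
  moreover have "0 < real s / real r" "real s / real r \<le> 1"
    using assms by auto
  ultimately show ?thesis
    by (intro ceiling_unique) auto
qed

theorem theorem4p6:
  fixes q r n m s d :: nat
  assumes "CARD('a :: {field, finite}) = q"
    and "r > 0"
    and "n > 0" and "n \<le> q - 1"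
    and "n = m * r + s" and "1 \<le> s" and "s \<le> r"
    and "d > 0" and "d \<le> s"
  shows "\<exists>C :: 'a vec set.
           singleton_optimal_lrc (n + nat \<lceil>real n / real r\<rceil>) (n - d + 1) (d + 1) r C"
proof -
  \<comment> \<open>The \<open>n \<le> q - 1\<close> evaluation points are chosen among the nonzero
    field elements.\<close>
  have "card (UNIV - {0 :: 'a}) = q - 1"
    using assms(1) by (simp add: card_Diff_singleton)
  then have "card {..<n} \<le> card (UNIV - {0 :: 'a})"
    using assms(4) by simp
  then obtain \<alpha> :: "nat \<Rightarrow> 'a" where \<alpha>: "inj_on \<alpha> {..<n}" "\<alpha> ` {..<n} \<subseteq> UNIV - {0}"
    using inj_on_iff_card_le[of "{..<n}" "UNIV - {0 :: 'a}"] by auto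
  interpret rs_lrc \<alpha> n "m + 1" r d
    using \<alpha> assms by unfold_locales auto
  have n_div: "\<lceil>real n / real r\<rceil> = int m + 1"
    using ceiling_divide_eq_Suc[of s r m] assms by simp
  \<comment> \<open>Since \<open>1 \<le> d \<le> s\<close>, the remainder \<open>s - d + 1\<close>
    stays between 1 and \<open>r\<close>. Length \<open>n\<close> and dimension
    \<open>n - d + 1\<close> thus give the same ceiling \<open>m + 1\<close>, which cancels the
    \<open>m + 1\<close> parities in the Singleton-type bound and leaves
    \<open>d + 1\<close>.\<close>
  have "n - d + 1 = m * r + (s - d + 1)"
    using assms by simp
  then have "\<lceil>real (n - d + 1) / real r\<rceil> = int m + 1"
    using ceiling_divide_eq_Suc[of "s - d + 1" r m] assms by simp
  then have "singleton_optimal (n + (m + 1)) (n - d + 1) (d + 1) r"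
    using d_le_n by (simp add: singleton_optimal_def of_nat_diff)
  moreover have "nat \<lceil>real n / real r\<rceil> = m + 1"
    by (simp add: n_div)
  ultimately show ?thesis
    using locally_repairable_code by (auto simp: singleton_optimal_lrc_def)
qed

end
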